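(* Let $n,m,k$ be positive integers with $m\le n$, and for an integer $t$ with $1\le t\le n$ define $$Q(k,m,t)=\sum_{i=0}^{t-m}(-1)^i\binom{t}{i}\binom{t-i}{m}^{k}$$ (the number of $k\times t$ $0$–$1$ matrices with exactly $m$ ones in each row and at least one $1$ in each column; empty sum $=0$ if $t<m$), and $$R(k,m,t)=\sum_{i=0}^{t-1}(-1)^i\binom{t}{i}(t-i)^{mk}.$$ Let $P=\left(\frac{n(n-1)\cdots(n-m+1)}{n^m}\right)^k$ be the probability that, when in each of $k$ independent stages $m$ nodes are chosen independently and uniformly (with repetition allowed) from a set of $n$ nodes, the $m$ chosen nodes are pairwise distinct in every stage. If $n,m,k\to\infty$ with $k\binom{m}{2}/n\to 0$, then for every $t$, $$\frac{\binom{n}{t}Q(k,m,t)}{\binom{n}{m}^{k}}\cdot P\le \frac{\binom{n}{t}R(k,m,t)}{n^{km}},$$ and $P\to 1$.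
   Context: Two allocation models over a set of $n$ nodes: $U_{n,k,\{m\}}$ consists of $k$ independent uniformly random $m$-element subsets of nodes (the left-hand side is the probability that their union has exactly $t$ nodes); $U_{n,k,m}$ consists of $k$ independent stages, each placing $m$ elements independently and uniformly on the $n$ nodes, giving $n^{km}$ equally likely ordered outcomes (the right-hand side is the probability that exactly $t$ distinct nodes are covered). *)

theory Defs
  imports "HOL-Probability.Probability_Mass_Function"
begin

text \<open>
  The upper summation limit \<open>t - m\<close> is an integer difference in the mathematics, so the sum is
  empty for \<open>t < m\<close>; truncated subtraction on \<^typ>\<open>nat\<close> would leave the summand \<open>i = 0\<close>.
\<close>
definition Q :: "nat \<Rightarrow> nat \<Rightarrow> nat \<Rightarrow> int" where
  "Q k m t =
     (if m \<le> t then \<Sum>i = 0..t - m. (-1) ^ i * int (t choose i) * int ((t - i) choose m) ^ k else 0)"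

definition R :: "nat \<Rightarrow> nat \<Rightarrow> nat \<Rightarrow> int" where
  "R k m t = (\<Sum>i = 0..t - 1. (-1) ^ i * int (t choose i) * int (t - i) ^ (m * k))"

definition zero_one_matrices :: "nat \<Rightarrow> nat \<Rightarrow> nat \<Rightarrow> (nat \<times> nat \<Rightarrow> nat) set" where
  "zero_one_matrices k m t =
     {A \<in> ({..<k} \<times> {..<t}) \<rightarrow>\<^sub>E {0, 1}.
        (\<forall>i<k. card {j. j < t \<and> A (i, j) = 1} = m) \<and> (\<forall>j<t. \<exists>i<k. A (i, j) = 1)}"

definition P :: "nat \<Rightarrow> nat \<Rightarrow> nat \<Rightarrow> real" where
  "P n m k = ((\<Prod>i<m. real n - real i) / real n ^ m) ^ k"

text \<open>
  An outcome \<open>f\<close> sends \<open>(s, e)\<close> to the node on which the \<open>e\<close>-th element of stage \<open>s\<close> is placed.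
  All \<open>n ^ (k * m)\<close> outcomes being equally likely expresses that the placements are independent
  and uniform.
\<close>
definition outcomes :: "nat \<Rightarrow> nat \<Rightarrow> nat \<Rightarrow> (nat \<times> nat \<Rightarrow> nat) set" where
  "outcomes n m k = ({..<k} \<times> {..<m}) \<rightarrow>\<^sub>E {..<n}"

definition all_stages_distinct :: "nat \<Rightarrow> nat \<Rightarrow> (nat \<times> nat \<Rightarrow> nat) set" where
  "all_stages_distinct m k = {f. \<forall>s<k. inj_on (\<lambda>e. f (s, e)) {..<m}}"

end

theory Submission
  imports Defs
begin

text \<open>
  Since \<open>P\<close> equals \<open>(m! * (n choose m)) ^ k / n ^ (k * m)\<close>, the inequality amounts to
  \<open>m! ^ k * Q k m t \<le> R k m t\<close>.  By Moebius inversion over the set of covered nodes, \<open>R\<close> counts the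
  placements that cover all \<open>t\<close> nodes and \<open>m! ^ k * Q\<close> counts those among them whose stages are
  all injective.  For the limit, the Weierstrass product inequality followed by Bernoulli's
  inequality gives \<open>1 - k * (m choose 2) / n \<le> P \<le> 1\<close>.
\<close>

section \<open>Moebius inversion over supports\<close>

lemma card_support_eq:
  fixes s :: "'a \<Rightarrow> 'b set"
  assumes "finite X" "finite V"
    and h: "\<And>U. U \<subseteq> V \<Longrightarrow> card {x \<in> X. s x \<subseteq> U} = h (card U)"
  shows "int (card {x \<in> X. s x = V}) =
    (\<Sum>i = 0..card V. (-1) ^ i * int (card V choose i) * int (h (card V - i)))"
proof -
  let ?t = "card V"
  \<comment> \<open>Sorting \<open>X\<close> by exact support makes the counts for
    \<open>s x \<subseteq> T\<close> subset sums of the counts for \<open>s x = T\<close>, and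
    Moebius inversion undoes such sums. The hypothesis on \<open>h\<close> enters only afterwards,
    for \<open>T \<subseteq> V\<close>.\<close>
  have "int (card {x \<in> X. s x = V}) =
      (\<Sum>T\<in>Pow V. (-1) ^ (?t - card T) * int (card {x \<in> X. s x \<subseteq> T}))"
  proof (rule inclusion_exclusion_mobius[OF _ \<open>finite V\<close>])
    fix S :: "'b set" assume "finite S"
    have "{x \<in> X. s x \<subseteq> S} = (\<Union>T\<in>Pow S. {x \<in> X. s x = T})" by auto
    then have "card {x \<in> X. s x \<subseteq> S} = (\<Sum>T\<in>Pow S. card {x \<in> X. s x = T})"
      using \<open>finite S\<close> \<open>finite X\<close> by (simp, subst card_UN_disjoint) auto
    then show "int (card {x \<in> X. s x \<subseteq> S}) = (\<Sum>T\<in>Pow S. int (card {x \<in> X. s x = T}))"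
      by simp
  qed
  also have "\<dots> = (\<Sum>T\<in>Pow V. (-1) ^ (?t - card T) * int (h (card T)))"
    by (intro sum.cong) (auto simp: h)
  \<comment> \<open>The summand depends on \<open>T\<close> only through its size, so the sum
    collapses along the fibres of \<open>card\<close>.\<close>
  also have "\<dots> = (\<Sum>j\<in>{..?t}. \<Sum>T\<in>{T \<in> Pow V. card T = j}. (-1) ^ (?t - card T) * int (h (card T)))"
    using \<open>finite V\<close> by (subst sum.group) (auto intro: card_mono)
  also have "\<dots> = (\<Sum>j\<in>{..?t}. int (?t choose j) * ((-1) ^ (?t - j) * int (h j)))"
    using \<open>finite V\<close> by (intro sum.cong) (auto simp: n_subsets)
  also have "\<dots> = (\<Sum>i = 0..?t. (-1) ^ i * int (?t choose i) * int (h (?t - i)))"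
    by (rule sum.reindex_bij_witness[of _ "\<lambda>i. ?t - i" "\<lambda>j. ?t - j"])
      (auto simp flip: binomial_symmetric)
  finally show ?thesis .
qed

section \<open>Counting placements and matrices supported in a given set\<close>

lemma prod_diff_eq_fact_mult_choose: "(\<Prod>i<m. c - i) = fact m * (c choose m)" for c m :: nat
proof (induction m)
  case (Suc m)
  \<comment> \<open>By the two absorption identities, both sides equal
    \<open>c * ((c - 1) choose m)\<close>. Truncated subtraction does no harm: if
    \<open>c < m\<close>, the factor at \<open>i = c\<close> is zero, as is the binomial.\<close>
  have "(c choose m) * (c - m) = Suc m * (c choose Suc m)"
    using binomial_absorb_comp[of c m] binomial_absorption[of m c] by (simp add: mult.commute)
  then show ?case
    using Suc by (simp add: algebra_simps)
qed simp

lemma card_inj_PiE: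
  assumes "finite A" "finite B"
  shows "card {g \<in> A \<rightarrow>\<^sub>E B. inj_on g A} = fact (card A) * (card B choose card A)"
  using card_inj_on_subset_funcset[OF assms order.refl]
  by (simp add: prod_diff_eq_fact_mult_choose atLeast0LessThan)

lemma finite_outcomes: "finite (outcomes n m k)"
  unfolding outcomes_def by (intro finite_PiE) auto

lemma outcomes_image_subset:
  assumes "U \<subseteq> {..<n}"
  shows "{f \<in> outcomes n m k. f ` ({..<k} \<times> {..<m}) \<subseteq> U} = ({..<k} \<times> {..<m}) \<rightarrow>\<^sub>E U"
  using assms unfolding outcomes_def PiE_def Pi_def image_subset_iff by blast

text \<open>Distinctness constrains each stage separately, so currying turns such a placement into
  \<open>k\<close> independent choices of an injection from \<open>{..<m}\<close> into
  \<open>U\<close>.\<close>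

lemma card_stagewise_injective:
  assumes "finite U"
  shows "card ((({..<k} \<times> {..<m}) \<rightarrow>\<^sub>E U) \<inter> all_stages_distinct m k) =
    (fact m * (card U choose m)) ^ k" (is "card ?F = _")
proof -
  let ?G = "{..<k} \<rightarrow>\<^sub>E {g \<in> {..<m} \<rightarrow>\<^sub>E U. inj_on g {..<m}}"
  have "bij_betw (\<lambda>f. \<lambda>s\<in>{..<k}. \<lambda>e\<in>{..<m}. f (s, e)) ?F ?G"
  proof (rule bij_betw_byWitness[where f' = "\<lambda>g. \<lambda>(s, e)\<in>{..<k} \<times> {..<m}. g s e"])
    show "\<forall>f\<in>?F. (\<lambda>(s, e)\<in>{..<k} \<times> {..<m}. (\<lambda>s\<in>{..<k}. \<lambda>e\<in>{..<m}. f (s, e)) s e) = f"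
      by (fastforce simp: fun_eq_iff PiE_def extensional_def)
    show "\<forall>g\<in>?G. (\<lambda>s\<in>{..<k}. \<lambda>e\<in>{..<m}. (\<lambda>(s, e)\<in>{..<k} \<times> {..<m}. g s e) (s, e)) = g"
    proof
      fix g assume g: "g \<in> ?G"
      show "(\<lambda>s\<in>{..<k}. \<lambda>e\<in>{..<m}. (\<lambda>(s, e)\<in>{..<k} \<times> {..<m}. g s e) (s, e)) = g"
      proof
        fix s
        show "(\<lambda>s\<in>{..<k}. \<lambda>e\<in>{..<m}. (\<lambda>(s, e)\<in>{..<k} \<times> {..<m}. g s e) (s, e)) s = g s"
        proof (cases "s < k")
          case True
          \<comment> \<open>Membership makes \<open>g s\<close> extensional, so both sides are
            \<open>undefined\<close> off \<open>{..<m}\<close>.\<close>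
          then have "g s \<in> {..<m} \<rightarrow>\<^sub>E U" using g by auto
          with True show ?thesis by (auto simp: fun_eq_iff PiE_def extensional_def)
        next
          case False
          with g show ?thesis by (auto simp: PiE_def extensional_def)
        qed
      qed
    qed
    show "(\<lambda>f. \<lambda>s\<in>{..<k}. \<lambda>e\<in>{..<m}. f (s, e)) ` ?F \<subseteq> ?G"
      by (auto simp: all_stages_distinct_def inj_on_def PiE_def Pi_def)
    show "(\<lambda>g. \<lambda>(s, e)\<in>{..<k} \<times> {..<m}. g s e) ` ?G \<subseteq> ?F"
      by (auto simp: all_stages_distinct_def inj_on_def PiE_def Pi_def)
  qed
  then have "card ?F = card ?G"
    by (rule bij_betw_same_card)
  also have "\<dots> = (fact m * (card U choose m)) ^ k"
    using assms by (simp add: card_PiE card_inj_PiE)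
  finally show ?thesis .
qed

text \<open>A 0-1 matrix is the sequence of its row supports. The column condition says that every
  row support lies in \<open>U\<close>, which leaves \<open>k\<close> independent choices of an
  \<open>m\<close>-subset of \<open>U\<close>.\<close>

lemma card_row_sum_matrices:
  fixes k t :: nat
  assumes "U \<subseteq> {..<t}"
  shows "card {A \<in> ({..<k} \<times> {..<t}) \<rightarrow>\<^sub>E {0, 1 :: nat}.
      (\<forall>i<k. card {j. j < t \<and> A (i, j) = 1} = m) \<and> {j. j < t \<and> (\<exists>i<k. A (i, j) = 1)} \<subseteq> U} =
    (card U choose m) ^ k" (is "card ?M = _")
proof -
  let ?G = "{..<k} \<rightarrow>\<^sub>E {B. B \<subseteq> U \<and> card B = m}"
  let ?rows = "\<lambda>A. \<lambda>i\<in>{..<k}. {j. j < t \<and> A (i, j) = (1 :: nat)}"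
  let ?mat = "\<lambda>g. \<lambda>(i, j)\<in>{..<k} \<times> {..<t}. if j \<in> g i then 1 else (0 :: nat)"
  have fin: "finite U" using finite_subset[OF assms] by simp
  have rows_mat: "{j. j < t \<and> ?mat g (i, j) = 1} = g i" if "g \<in> ?G" "i < k" for g i
  proof -
    \<comment> \<open>Since \<open>U\<close> lies in \<open>{..<t}\<close>, cutting
      \<open>g i\<close> down to indices below \<open>t\<close> loses nothing.\<close>
    have "g i \<subseteq> U" using PiE_mem[OF that(1), of i] \<open>i < k\<close> by simp
    then have "\<And>j. j \<in> g i \<Longrightarrow> j < t" using assms by blast
    with \<open>i < k\<close> show ?thesis by auto
  qed
  have "bij_betw ?rows ?M ?G"
  proof (rule bij_betw_byWitness[where f' = ?mat])
    show "\<forall>A\<in>?M. ?mat (?rows A) = A"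
    proof
      fix A assume "A \<in> ?M"
      then have A: "A \<in> ({..<k} \<times> {..<t}) \<rightarrow>\<^sub>E {0, 1}" by simp
      show "?mat (?rows A) = A"
      proof
        fix p
        show "?mat (?rows A) p = A p"
        proof (cases "p \<in> {..<k} \<times> {..<t}")
          case True
          \<comment> \<open>The row supports only record where the entry is 1; every other entry is
            recovered as 0 because there are just two values.\<close>
          then have "A p = 0 \<or> A p = 1" using PiE_mem[OF A True] by simp
          with True show ?thesis by (cases p) auto
        next
          case False
          then show ?thesis using PiE_arb[OF A False] by auto
        qed
      qed
    qed
    show "\<forall>g\<in>?G. ?rows (?mat g) = g"
    proof
      fix g assume g: "g \<in> ?G"
      show "?rows (?mat g) = g"
      proof
        fix i
        show "?rows (?mat g) i = g i"
          using g rows_mat[OF g] by (cases "i < k") (auto simp: PiE_def extensional_def)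
      qed
    qed
    show "?rows ` ?M \<subseteq> ?G" by (fastforce simp: subset_iff)
    show "?mat ` ?G \<subseteq> ?M"
    proof
      fix A assume "A \<in> ?mat ` ?G"
      then obtain g where g: "g \<in> ?G" and A: "A = ?mat g" by blast
      have rows: "{j. j < t \<and> A (i, j) = 1} = g i" if "i < k" for i
        unfolding A by (rule rows_mat[OF g that])
      have gi: "g i \<subseteq> U" "card (g i) = m" if "i < k" for i using g that by auto
      have "A \<in> ({..<k} \<times> {..<t}) \<rightarrow>\<^sub>E {0, 1}" unfolding A by (auto split: if_splits)
      moreover have "{j. j < t \<and> (\<exists>i<k. A (i, j) = 1)} \<subseteq> U" using rows gi by blast
      ultimately show "A \<in> ?M" using rows gi by simp
    qed
  qed
  then have "card ?M = card ?G"
    by (rule bij_betw_same_card)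
  also have "\<dots> = (card U choose m) ^ k"
    using fin by (simp add: card_PiE n_subsets)
  finally show ?thesis .
qed

section \<open>\<open>Q\<close> and \<open>R\<close> as counts of configurations that cover
  everything\<close>

lemma Q_eq_full_sum:
  assumes "0 < m" "0 < k"
  shows "Q k m t = (\<Sum>i = 0..t. (-1) ^ i * int (t choose i) * int (((t - i) choose m) ^ k))"
proof (cases "m \<le> t")
  case True
  have "(\<Sum>i = 0..t - m. (-1) ^ i * int (t choose i) * int ((t - i) choose m) ^ k) =
      (\<Sum>i = 0..t. (-1) ^ i * int (t choose i) * int ((t - i) choose m) ^ k)"
    \<comment> \<open>For \<open>i > t - m\<close> the binomial \<open>(t - i) choose m\<close> is
      0, and its \<open>k\<close>-th power vanishes because \<open>k\<close> is positive.\<close>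
    using assms by (intro sum.mono_neutral_left) (auto simp: binomial_eq_0)
  with True show ?thesis by (simp add: Q_def)
next
  case False
  \<comment> \<open>When \<open>t < m\<close> every summand vanishes for the same reason, which
    agrees with the \<open>else\<close> branch of \<open>Q\<close>.\<close>
  with assms show ?thesis by (simp add: Q_def binomial_eq_0 zero_power)
qed

text \<open>Take the set of nonzero columns as the support of a matrix: having no empty column means
  having full support.\<close>

lemma Q_eq_card_zero_one_matrices:
  assumes "0 < m" "0 < k"
  shows "Q k m t = int (card (zero_one_matrices k m t))"
proof -
  let ?X = "{A \<in> ({..<k} \<times> {..<t}) \<rightarrow>\<^sub>E {0, 1 :: nat}. \<forall>i<k. card {j. j < t \<and> A (i, j) = 1} = m}"
  let ?s = "\<lambda>A. {j. j < t \<and> (\<exists>i<k. A (i, j) = (1 :: nat))}"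
  have "finite (({..<k} \<times> {..<t}) \<rightarrow>\<^sub>E {0, 1 :: nat})"
    by (intro finite_PiE) auto
  then have "finite ?X" by simp
  moreover have "card {A \<in> ?X. ?s A \<subseteq> U} = (card U choose m) ^ k" if "U \<subseteq> {..<t}" for U
    using card_row_sum_matrices[OF that, of k m] by (simp add: conj_assoc)
  ultimately have "int (card {A \<in> ?X. ?s A = {..<t}}) = Q k m t"
    using card_support_eq[of ?X "{..<t}" ?s "\<lambda>u. (u choose m) ^ k"]
    by (simp add: Q_eq_full_sum[OF assms])
  moreover have "{A \<in> ?X. ?s A = {..<t}} = zero_one_matrices k m t"
    by (auto simp: zero_one_matrices_def)
  ultimately show ?thesis by simp
qed

lemma R_eq_card_surjective_outcomes:
  assumes "0 < m" "0 < k" "0 < t"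
  shows "R k m t = int (card {f \<in> outcomes t m k. f ` ({..<k} \<times> {..<m}) = {..<t}})"
proof -
  have "card {f \<in> outcomes t m k. f ` ({..<k} \<times> {..<m}) \<subseteq> U} = card U ^ (m * k)"
    if "U \<subseteq> {..<t}" for U
    by (simp add: outcomes_image_subset[OF that] card_funcsetE mult.commute[of k m])
  then have "int (card {f \<in> outcomes t m k. f ` ({..<k} \<times> {..<m}) = {..<t}}) =
      (\<Sum>i = 0..t. (-1) ^ i * int (t choose i) * int ((t - i) ^ (m * k)))"
    using card_support_eq[of "outcomes t m k" "{..<t}" "\<lambda>f. f ` ({..<k} \<times> {..<m})" "\<lambda>u. u ^ (m * k)"]
    by (simp add: finite_outcomes)
  also have "\<dots> = R k m t"
    \<comment> \<open>Only the term \<open>i = t\<close> is added, and it is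
      \<open>0 ^ (m * k) = 0\<close>.\<close>
    unfolding R_def using assms by (intro sum.mono_neutral_cong_right) auto
  finally show ?thesis by simp
qed

text \<open>Each \<open>m\<close>-subset chosen in a stage arises from \<open>m!\<close> orderings.
  In the inversion formula this appears as a factor \<open>fact m ^ k\<close> common to all
  summands.\<close>

lemma fact_power_mult_Q_eq_card:
  assumes "0 < m" "0 < k"
  shows "fact m ^ k * Q k m t =
    int (card {f \<in> outcomes t m k \<inter> all_stages_distinct m k. f ` ({..<k} \<times> {..<m}) = {..<t}})"
proof -
  let ?X = "outcomes t m k \<inter> all_stages_distinct m k"
  have "card {f \<in> ?X. f ` ({..<k} \<times> {..<m}) \<subseteq> U} = (fact m * (card U choose m)) ^ k"
    if "U \<subseteq> {..<t}" for U
  proof -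
    have "{f \<in> ?X. f ` ({..<k} \<times> {..<m}) \<subseteq> U} =
        {f \<in> outcomes t m k. f ` ({..<k} \<times> {..<m}) \<subseteq> U} \<inter> all_stages_distinct m k"
      by (rule set_eqI) (simp only: Int_iff mem_Collect_eq conj_ac)
    also have "\<dots> = (({..<k} \<times> {..<m}) \<rightarrow>\<^sub>E U) \<inter> all_stages_distinct m k"
      by (simp only: outcomes_image_subset[OF that])
    finally have "{f \<in> ?X. f ` ({..<k} \<times> {..<m}) \<subseteq> U} =
        (({..<k} \<times> {..<m}) \<rightarrow>\<^sub>E U) \<inter> all_stages_distinct m k" .
    then show ?thesis
      using card_stagewise_injective[of U k m] finite_subset[OF that] by simp
  qed
  then have "int (card {f \<in> ?X. f ` ({..<k} \<times> {..<m}) = {..<t}}) =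
      (\<Sum>i = 0..t. (-1) ^ i * int (t choose i) * int ((fact m * ((t - i) choose m)) ^ k))"
    using card_support_eq[of ?X "{..<t}" "\<lambda>f. f ` ({..<k} \<times> {..<m})" "\<lambda>u. (fact m * (u choose m)) ^ k"]
    by (simp add: finite_outcomes)
  also have "\<dots> = fact m ^ k * Q k m t"
    by (simp add: Q_eq_full_sum[OF assms] sum_distrib_left power_mult_distrib mult.left_commute)
  finally show ?thesis by simp
qed

text \<open>Both sides count covering placements, the left one under the extra condition of
  distinctness in every stage.\<close>

lemma fact_power_mult_Q_le_R:
  assumes "0 < m" "0 < k" "0 < t"
  shows "fact m ^ k * Q k m t \<le> R k m t"
  unfolding R_eq_card_surjective_outcomes[OF assms] fact_power_mult_Q_eq_card[OF assms(1,2)]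
  by (intro of_nat_mono card_mono) (auto simp: finite_outcomes)

section \<open>The probability \<open>P\<close>, its lower bound and its limit\<close>

lemma P_eq:
  assumes "m \<le> n"
  shows "P n m k = (fact m * real (n choose m)) ^ k / real n ^ (k * m)"
proof -
  have "(\<Prod>i<m. real n - real i) = real (\<Prod>i<m. n - i)"
    using assms by (simp add: of_nat_diff)
  also have "\<dots> = fact m * real (n choose m)"
    by (simp add: prod_diff_eq_fact_mult_choose)
  finally show ?thesis
    by (simp add: P_def power_divide mult.commute[of k m] power_mult)
qed

lemma P_eq_prob:
  assumes "m \<le> n" "0 < n"
  shows "P n m k = measure_pmf.prob (pmf_of_set (outcomes n m k)) (all_stages_distinct m k)"
proof -
  have "outcomes n m k \<noteq> {}"
    using assms by (auto simp: outcomes_def PiE_eq_empty_iff)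
  then have "measure_pmf.prob (pmf_of_set (outcomes n m k)) (all_stages_distinct m k) =
      card (outcomes n m k \<inter> all_stages_distinct m k) / card (outcomes n m k)"
    by (simp add: measure_pmf_of_set finite_outcomes)
  also have "card (outcomes n m k) = n ^ (k * m)"
    by (simp add: outcomes_def card_funcsetE)
  also have "card (outcomes n m k \<inter> all_stages_distinct m k) = (fact m * (n choose m)) ^ k"
    using card_stagewise_injective[of "{..<n}" k m] by (simp add: outcomes_def)
  finally show ?thesis
    by (simp add: P_eq[OF assms(1)])
qed

text \<open>Weierstrass product inequality: a new factor \<open>1 - x m\<close> lowers the product
  by \<open>x m\<close> times a product that is at most 1, hence by at most
  \<open>x m\<close>.\<close>

lemma one_minus_sum_le_prod:
  fixes x :: "nat \<Rightarrow> real"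
  assumes "\<And>i. i < m \<Longrightarrow> 0 \<le> x i \<and> x i \<le> 1"
  shows "1 - (\<Sum>i<m. x i) \<le> (\<Prod>i<m. 1 - x i)"
  using assms
proof (induction m)
  case (Suc m)
  have "(\<Prod>i<m. 1 - x i) \<le> 1"
    using Suc.prems by (intro prod_le_1) auto
  then have "x m * (\<Prod>i<m. 1 - x i) \<le> x m"
    using Suc.prems[of m] by (simp add: mult_left_le)
  moreover have "1 - (\<Sum>i<m. x i) \<le> (\<Prod>i<m. 1 - x i)"
    using Suc by simp
  ultimately show ?case by (simp add: algebra_simps)
qed simp

lemma P_ge:
  assumes "m \<le> n" "0 < n"
  shows "1 - real k * real (m choose 2) / real n \<le> P n m k"
proof -
  \<comment> \<open>\<open>a\<close> is the probability of distinctness in a single stage, so that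
    \<open>P = a ^ k\<close>.\<close>
  define a where "a = (\<Prod>i<m. real n - real i) / real n ^ m"
  have "(\<Prod>i<m. 1 - real i / real n) = (\<Prod>i<m. (real n - real i) / real n)"
    using assms by (simp add: diff_divide_distrib)
  then have a: "a = (\<Prod>i<m. 1 - real i / real n)"
    by (simp add: a_def prod_dividef)
  have "0 \<le> a"
    unfolding a using assms by (intro prod_nonneg) auto
  have "(\<Sum>i<m. real i / real n) = real (\<Sum>i<m. i) / real n"
    by (simp add: sum_divide_distrib)
  also have "(\<Sum>i<m. i) = m choose 2"
    by (induction m) (auto simp: numeral_2_eq_2)
  finally have "1 - real (m choose 2) / real n \<le> a"
    unfolding a using one_minus_sum_le_prod[of m "\<lambda>i. real i / real n"] assms by simp
  then have "real k * (1 - a) \<le> real k * (real (m choose 2) / real n)"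
    by (intro mult_left_mono) auto
  \<comment> \<open>Bernoulli's inequality needs \<open>a - 1 \<ge> -1\<close>, which is where
    \<open>0 \<le> a\<close> enters.\<close>
  moreover have "1 + real k * (a - 1) \<le> a ^ k"
    using Bernoulli_inequality[of "a - 1" k] \<open>0 \<le> a\<close> by simp
  ultimately show ?thesis
    unfolding P_def a_def[symmetric] by (simp add: algebra_simps)
qed

lemma mult_P_le:
  assumes "0 < n" "0 < m" "0 < k" "m \<le> n" "0 < t"
  shows "real (n choose t) * of_int (Q k m t) / real (n choose m) ^ k * P n m k
    \<le> real (n choose t) * of_int (R k m t) / real n ^ (k * m)"
proof -
  \<comment> \<open>The factor \<open>(n choose m) ^ k\<close> in \<open>P\<close> cancels the
    denominator; it is nonzero because \<open>m \<le> n\<close>.\<close>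
  have "real (n choose t) * of_int (Q k m t) / real (n choose m) ^ k * P n m k =
      real (n choose t) * of_int (fact m ^ k * Q k m t) / real n ^ (k * m)"
    using assms by (simp add: P_eq power_mult_distrib)
  also have "\<dots> \<le> real (n choose t) * of_int (R k m t) / real n ^ (k * m)"
    using fact_power_mult_Q_le_R[OF assms(2,3,5)]
    by (intro divide_right_mono mult_left_mono) (auto simp: of_int_le_iff simp del: of_int_mult)
  finally show ?thesis .
qed

theorem theorem2:
  fixes n m k :: "nat \<Rightarrow> nat"
  assumes "\<And>j. 0 < n j" and "\<And>j. 0 < m j" and "\<And>j. 0 < k j"
    and "\<And>j. m j \<le> n j"
    and "filterlim n at_top sequentially"
    and "filterlim m at_top sequentially"
    and "filterlim k at_top sequentially"
    and "(\<lambda>j. real (k j) * real (m j choose 2) / real (n j)) \<longlonglongrightarrow> 0"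
  shows
    "(\<forall>j. \<forall>t\<in>{1..n j}. Q (k j) (m j) t = int (card (zero_one_matrices (k j) (m j) t))) \<and>
     (\<forall>j. P (n j) (m j) (k j) =
        measure_pmf.prob (pmf_of_set (outcomes (n j) (m j) (k j))) (all_stages_distinct (m j) (k j))) \<and>
     (\<forall>j. \<forall>t\<in>{1..n j}.
        real (n j choose t) * of_int (Q (k j) (m j) t) / real (n j choose m j) ^ k j * P (n j) (m j) (k j)
          \<le> real (n j choose t) * of_int (R (k j) (m j) t) / real (n j) ^ (k j * m j)) \<and>
     (\<lambda>j. P (n j) (m j) (k j)) \<longlonglongrightarrow> 1"
proof (intro conjI allI ballI)
  show "(\<lambda>j. P (n j) (m j) (k j)) \<longlonglongrightarrow> 1"
  proof (rule tendsto_sandwich)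
    show "\<forall>\<^sub>F j in sequentially.
        1 - real (k j) * real (m j choose 2) / real (n j) \<le> P (n j) (m j) (k j)"
      using assms by (simp add: P_ge)
    \<comment> \<open>The upper bound is immediate once \<open>P\<close> is read as a
      probability.\<close>
    show "\<forall>\<^sub>F j in sequentially. P (n j) (m j) (k j) \<le> 1"
      using assms by (simp add: P_eq_prob)
    show "(\<lambda>j. 1 - real (k j) * real (m j choose 2) / real (n j)) \<longlonglongrightarrow> 1"
      using tendsto_diff[OF tendsto_const assms(8), of 1] by simp
  qed simp
next
  fix j t assume "t \<in> {1..n j}"
  then show "real (n j choose t) * of_int (Q (k j) (m j) t) / real (n j choose m j) ^ k j * P (n j) (m j) (k j)
      \<le> real (n j choose t) * of_int (R (k j) (m j) t) / real (n j) ^ (k j * m j)"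
    using assms by (intro mult_P_le) auto
qed (use assms in \<open>simp_all add: Q_eq_card_zero_one_matrices P_eq_prob\<close>)

end
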